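(* Let $\mathcal{A}=\{x_1,\dots,x_M\}\subset\mathbb{C}$, $M\ge 2$, be the unit-modulus $M$-PSK constellation, let $x_p\neq x_q$ be two of its points, let $\epsilon\in(0,1)$, $N_{r,d}>0$, and let $y_{r,d}[n-1],y_{r,d}[n]\in\mathbb{C}$. For $i=1,\dots,M$ put $s_i=\frac{1}{N_{r,d}}\mathrm{Re}\{y_{r,d}^*[n]\,y_{r,d}[n-1]\,x_i\}$, and set $$a=\frac{\epsilon}{M-1}\sum_{i\ne p,q}e^{s_i},\qquad g_1=(1-\epsilon)e^{s_p}+\frac{\epsilon}{M-1}e^{s_q},\qquad g_2=(1-\epsilon)e^{s_q}+\frac{\epsilon}{M-1}e^{s_p}.$$ Let $t=\frac{1}{N_{r,d}}\mathrm{Re}\{y_{r,d}^*[n]\,y_{r,d}[n-1]\,(x_p-x_q)\}$ and $$f(t)=\ln\left(\frac{(1-\epsilon)e^{t}+\frac{\epsilon}{M-1}}{(1-\epsilon)+\frac{\epsilon}{M-1}e^{t}}\right).$$ Then the log-likelihood-ratio decision rule based on $\ln\frac{a+g_1}{a+g_2}$ (decide $x_p$ if positive, $x_q$ if negative) is the same as the rule based on $\ln\frac{g_1}{g_2}=f(t)$; that is, $\ln\frac{a+g_1}{a+g_2}$ and $f(t)$ are both positive, both zero, or both negative. Moreover, $f(t)\to \ln\frac{(M-1)(1-\epsilon)}{\epsilon}$ as $t\to+\infty$ and $f(t)\to-\ln\frac{(M-1)(1-\epsilon)}{\epsilon}$ as $t\to-\infty$.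
   Context: Here $^*$ is complex conjugation. The quantity $\ln\frac{a+g_1}{a+g_2}$ is the log-likelihood ratio of the hypotheses $x[n]=x_p$ and $x[n]=x_q$ at the destination when only the relay-destination link is present. In this model the relay forwards the correct symbol with probability $1-\epsilon$ and each wrong symbol with probability $\epsilon/(M-1)$, and, given the forwarded symbol $x_r$, $y_{r,d}[n]$ is circular complex Gaussian with mean $y_{r,d}[n-1]x_r$ and variance $2N_{r,d}$. *)

theory Defs
  imports "HOL-Probability.Probability"
begin

text \<open>The reference phase \<open>\<phi>\<close> is arbitrary, so that both \<open>{1, \<i>, -1, -\<i>}\<close> and its rotation by
  \<open>pi/4\<close> count as 4-PSK.\<close>

definition psk_constellation :: "nat \<Rightarrow> real \<Rightarrow> complex set" where
  "psk_constellation M \<phi> = {cis (\<phi> + 2 * pi * real k / real M) | k. k < M}"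

text \<open>Circular symmetry with variance \<open>v\<close>, the expected squared modulus of the deviation from
  the mean: the real and imaginary parts are independent, each of variance \<open>v / 2\<close>
  (\<^const>\<open>normal_density\<close> takes the standard deviation).\<close>

definition circular_gaussian_density :: "complex \<Rightarrow> real \<Rightarrow> complex \<Rightarrow> real" where
  "circular_gaussian_density m v y =
     normal_density (Re m) (sqrt (v / 2)) (Re y) * normal_density (Im m) (sqrt (v / 2)) (Im y)"

definition forward_prob :: "nat \<Rightarrow> real \<Rightarrow> nat \<Rightarrow> nat \<Rightarrow> real" where
  "forward_prob M \<epsilon> i r = (if r = i then 1 - \<epsilon> else \<epsilon> / (real M - 1))"

text \<open>Likelihood, under the hypothesis that the source sent \<open>x i\<close>, of receiving \<open>y\<close> at the destination
  when the previously received sample was \<open>y'\<close>; the sum runs over the symbol \<open>x r\<close> that the relay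
  forwards.\<close>

definition relay_likelihood ::
  "nat \<Rightarrow> (nat \<Rightarrow> complex) \<Rightarrow> real \<Rightarrow> real \<Rightarrow> complex \<Rightarrow> complex \<Rightarrow> nat \<Rightarrow> real" where
  "relay_likelihood M x \<epsilon> N y' y i =
     (\<Sum>r = 1..M. forward_prob M \<epsilon> i r * circular_gaussian_density (y' * x r) (2 * N) y)"

text \<open>The rule leaves ties undecided (\<^const>\<open>None\<close>).\<close>

definition llr_decision :: "real \<Rightarrow> 'a \<Rightarrow> 'a \<Rightarrow> 'a option" where
  "llr_decision L u v = (if L > 0 then Some u else if L < 0 then Some v else None)"

end

theory Submission
  imports Defs "HOL-Real_Asymp.Real_Asymp"
begin

text \<open>
  Because the constellation points have equal modulus, each Gaussian density
  is the exponential \<open>exp (s\<^sub>i)\<close> times a factor independent of \<open>i\<close>. This factor cancels in the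
  likelihood ratio, which becomes \<open>(a + g\<^sub>1) / (a + g\<^sub>2)\<close>. The sign of the logarithm of a ratio of
  positive numbers is the sign of their difference, and adding \<open>a\<close> to both numbers preserves it.
\<close>

lemma norm_psk_constellation:
  assumes "z \<in> psk_constellation M \<phi>"
  shows "cmod z = 1"
  using assms by (auto simp: psk_constellation_def)

text \<open>Each coordinate has variance \<open>v / 2\<close>, so the two exponents add up to the
  squared modulus over \<open>v\<close>, and the normalising factors
  \<open>1 / sqrt (pi * v)\<close> multiply.\<close>

lemma circular_gaussian_density_eq:
  assumes "v > 0"
  shows "circular_gaussian_density m v y = exp (- (cmod (y - m))\<^sup>2 / v) / (pi * v)"
  using assms
  by (simp add: circular_gaussian_density_def normal_density_def cmod_power2
      flip: exp_add real_sqrt_mult) (simp add: add_divide_distrib diff_divide_distrib)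

text \<open>Expand the squared distance: since \<open>cmod z = 1\<close>, the term
  \<open>cmod (y' * z)\<close> does not depend on \<open>z\<close>, and only the cross term is left
  to carry it.\<close>

lemma circular_gaussian_density_unit_rotation:
  assumes "N > 0" "cmod z = 1"
  shows "circular_gaussian_density (y' * z) (2 * N) y
    = exp (- ((cmod y)\<^sup>2 + (cmod y')\<^sup>2) / (2 * N)) / (2 * pi * N) * exp (1 / N * Re (cnj y * y' * z))"
proof -
  have "(cmod (y - y' * z))\<^sup>2 = (cmod y)\<^sup>2 + (cmod (y' * z))\<^sup>2 - 2 * Re (cnj y * (y' * z))"
    unfolding cmod_power2 by (simp add: power2_eq_square algebra_simps)
  then have "(cmod (y - y' * z))\<^sup>2 = (cmod y)\<^sup>2 + (cmod y')\<^sup>2 - 2 * Re (cnj y * y' * z)"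
    using assms by (simp only: norm_mult mult.assoc mult_1_right)
  then have "- (cmod (y - y' * z))\<^sup>2 / (2 * N)
      = - ((cmod y)\<^sup>2 + (cmod y')\<^sup>2) / (2 * N) + 1 / N * Re (cnj y * y' * z)"
    using assms by (simp only:) (simp add: field_simps)
  then show ?thesis
    using assms by (simp only: circular_gaussian_density_eq exp_add) simp
qed

text \<open>All symbols other than \<open>i\<close> have the same weight. Splitting off
  \<open>j\<close> as well leaves a remainder symmetric in \<open>i\<close> and \<open>j\<close>,
  hence common to both hypotheses.\<close>

lemma sum_forward_prob:
  assumes "i \<in> {1..M}" "j \<in> {1..M}" "i \<noteq> j"
  shows "(\<Sum>r = 1..M. forward_prob M \<epsilon> i r * h r)
    = \<epsilon> / (real M - 1) * (\<Sum>r\<in>{1..M} - {i, j}. h r)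
      + ((1 - \<epsilon>) * h i + \<epsilon> / (real M - 1) * h j)"
proof -
  have "(\<Sum>r = 1..M. forward_prob M \<epsilon> i r * h r)
      = (\<Sum>r\<in>{1..M} - {i, j}. forward_prob M \<epsilon> i r * h r)
        + (\<Sum>r\<in>{i, j}. forward_prob M \<epsilon> i r * h r)"
    using assms by (intro sum.subset_diff) auto
  also have "(\<Sum>r\<in>{1..M} - {i, j}. forward_prob M \<epsilon> i r * h r)
      = \<epsilon> / (real M - 1) * (\<Sum>r\<in>{1..M} - {i, j}. h r)"
    unfolding sum_distrib_left by (intro sum.cong) (auto simp: forward_prob_def)
  finally show ?thesis
    using assms by (simp add: forward_prob_def)
qed

text \<open>Passing to a difference lets a summand common to \<open>u\<close> and \<open>v\<close>
  cancel.\<close>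

lemma sgn_ln_divide:
  fixes u v :: real
  assumes "u > 0" "v > 0"
  shows "sgn (ln (u / v)) = sgn (u - v)"
  using assms by (simp add: ln_div sgn_if)

lemma llr_decision_cong_sgn:
  assumes "sgn L = sgn L'"
  shows "llr_decision L u v = llr_decision L' u v"
  using assms by (auto simp: llr_decision_def sgn_if split: if_splits)

lemma tendsto_ln_exp_ratio_at_top:
  fixes b c :: real
  assumes "b > 0" "c > 0"
  shows "((\<lambda>u. ln ((b * exp u + c) / (b + c * exp u))) \<longlongrightarrow> ln (b / c)) at_top"
  using assms by (real_asymp simp: field_simps)

lemma tendsto_ln_exp_ratio_at_bot:
  fixes b c :: real
  assumes "b > 0" "c > 0"
  shows "((\<lambda>u. ln ((b * exp u + c) / (b + c * exp u))) \<longlongrightarrow> - ln (b / c)) at_bot"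
proof -
  \<comment> \<open>Here \<open>exp u\<close> vanishes, so the constant terms determine the limit,
    the reciprocal of the one at \<open>at_top\<close>.\<close>
  have "((\<lambda>u. ln ((b * exp u + c) / (b + c * exp u))) \<longlongrightarrow> ln (c / b)) at_bot"
    using assms by (real_asymp simp: field_simps)
  then show ?thesis
    using assms by (simp add: ln_div)
qed

theorem mainTheorem3:
  fixes M p q :: nat
    and x :: "nat \<Rightarrow> complex"
    and \<phi> \<epsilon> N a g1 g2 t :: real
    and y_prev y :: complex
    and s :: "nat \<Rightarrow> real"
    and f :: "real \<Rightarrow> real"
  assumes M: "M \<ge> 2"
    and x: "bij_betw x {1..M} (psk_constellation M \<phi>)"
    and p: "p \<in> {1..M}" and q: "q \<in> {1..M}" and pq: "x p \<noteq> x q"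
    and eps: "0 < \<epsilon>" "\<epsilon> < 1"
    and N: "N > 0"
    and s: "\<And>i. i \<in> {1..M} \<Longrightarrow> s i = 1 / N * Re (cnj y * y_prev * x i)"
    and a: "a = \<epsilon> / (real M - 1) * (\<Sum>i\<in>{1..M} - {p, q}. exp (s i))"
    and g1: "g1 = (1 - \<epsilon>) * exp (s p) + \<epsilon> / (real M - 1) * exp (s q)"
    and g2: "g2 = (1 - \<epsilon>) * exp (s q) + \<epsilon> / (real M - 1) * exp (s p)"
    and t: "t = 1 / N * Re (cnj y * y_prev * (x p - x q))"
    and f: "\<And>u. f u = ln (((1 - \<epsilon>) * exp u + \<epsilon> / (real M - 1))
                          / ((1 - \<epsilon>) + \<epsilon> / (real M - 1) * exp u))"
  shows "ln (relay_likelihood M x \<epsilon> N y_prev y p / relay_likelihood M x \<epsilon> N y_prev y q)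
           = ln ((a + g1) / (a + g2))
    \<and> ln (g1 / g2) = f t
    \<and> llr_decision (ln ((a + g1) / (a + g2))) (x p) (x q) = llr_decision (f t) (x p) (x q)
    \<and> ((ln ((a + g1) / (a + g2)) > 0 \<and> f t > 0)
       \<or> (ln ((a + g1) / (a + g2)) = 0 \<and> f t = 0)
       \<or> (ln ((a + g1) / (a + g2)) < 0 \<and> f t < 0))
    \<and> (f \<longlongrightarrow> ln ((real M - 1) * (1 - \<epsilon>) / \<epsilon>)) at_top
    \<and> (f \<longlongrightarrow> - ln ((real M - 1) * (1 - \<epsilon>) / \<epsilon>)) at_bot"
proof -
  define c where "c = \<epsilon> / (real M - 1)"
  define b where "b = 1 - \<epsilon>"
  \<comment> \<open>The part of the Gaussian density that is the same for every forwarded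
    symbol.\<close>
  define K where "K = exp (- ((cmod y)\<^sup>2 + (cmod y_prev)\<^sup>2) / (2 * N)) / (2 * pi * N)"
  have c_pos: "c > 0" and b_pos: "b > 0" and K_pos: "K > 0"
    using M eps N by (auto simp: c_def b_def K_def)
  have neq: "p \<noteq> q"
    using pq by auto
  \<comment> \<open>Not strict: for \<open>M = 2\<close> the sum is empty and
    \<open>a = 0\<close>.\<close>
  have a_nonneg: "a \<ge> 0"
    using c_pos unfolding a c_def[symmetric] by (intro mult_nonneg_nonneg sum_nonneg) auto
  have g_pos: "g1 > 0" "g2 > 0"
    using b_pos c_pos unfolding g1 g2 c_def[symmetric] b_def[symmetric]
    by (auto intro!: add_pos_pos)
  have f_eq: "f = (\<lambda>u. ln ((b * exp u + c) / (b + c * exp u)))"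
    using f by (auto simp: b_def c_def)
  have "relay_likelihood M x \<epsilon> N y_prev y i = K * (\<Sum>r = 1..M. forward_prob M \<epsilon> i r * exp (s r))" for i
    unfolding relay_likelihood_def sum_distrib_left
  proof (intro sum.cong refl)
    fix r assume r: "r \<in> {1..M}"
    then have "cmod (x r) = 1"
      using x by (intro norm_psk_constellation[of _ M \<phi>]) (auto dest: bij_betwE)
    then show "forward_prob M \<epsilon> i r * circular_gaussian_density (y_prev * x r) (2 * N) y
        = K * (forward_prob M \<epsilon> i r * exp (s r))"
      using N r by (simp only: circular_gaussian_density_unit_rotation s K_def) simp
  qed
  then have "relay_likelihood M x \<epsilon> N y_prev y p = K * (a + g1)"
      and "relay_likelihood M x \<epsilon> N y_prev y q = K * (a + g2)"
    using sum_forward_prob[OF p q neq, of \<epsilon> "\<lambda>r. exp (s r)"]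
      sum_forward_prob[OF q p neq[symmetric], of \<epsilon> "\<lambda>r. exp (s r)"]
    \<comment> \<open>\<open>insert_commute\<close> identifies \<open>{q, p}\<close>, from the
      instance with exchanged roles, with the \<open>{p, q}\<close> in \<open>a\<close>.\<close>
    by (simp_all only: a g1 g2 insert_commute)
  then have likelihood: "ln (relay_likelihood M x \<epsilon> N y_prev y p / relay_likelihood M x \<epsilon> N y_prev y q)
      = ln ((a + g1) / (a + g2))"
    using K_pos by simp
  have "s p = s q + t"
    using p q by (simp add: s t algebra_simps diff_divide_distrib add_divide_distrib)
  \<comment> \<open>The common factor \<open>exp (s q)\<close> cancels in \<open>g1 / g2\<close>,
    leaving a function of \<open>t\<close> alone.\<close>
  then have "g1 = exp (s q) * (b * exp t + c)" "g2 = exp (s q) * (b + c * exp t)"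
    unfolding g1 g2 by (simp_all add: b_def c_def exp_add algebra_simps)
  then have ratio: "ln (g1 / g2) = f t"
    by (simp add: f_eq)
  have sgn: "sgn (ln ((a + g1) / (a + g2))) = sgn (f t)"
    \<comment> \<open>Both signs equal that of \<open>g1 - g2\<close>.\<close>
    using a_nonneg g_pos by (simp add: sgn_ln_divide flip: ratio)
  then have trichotomy: "(ln ((a + g1) / (a + g2)) > 0 \<and> f t > 0)
       \<or> (ln ((a + g1) / (a + g2)) = 0 \<and> f t = 0)
       \<or> (ln ((a + g1) / (a + g2)) < 0 \<and> f t < 0)"
    by (auto simp: sgn_if split: if_splits)
  have bc: "(real M - 1) * (1 - \<epsilon>) / \<epsilon> = b / c"
    by (simp add: b_def c_def)
  have "(f \<longlongrightarrow> ln (b / c)) at_top" "(f \<longlongrightarrow> - ln (b / c)) at_bot"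
    unfolding f_eq using b_pos c_pos
    by (rule tendsto_ln_exp_ratio_at_top tendsto_ln_exp_ratio_at_bot)+
  then show ?thesis
    unfolding bc by (intro conjI likelihood ratio llr_decision_cong_sgn[OF sgn] trichotomy)
qed

end
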